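(* $(\mathbb{H},\tau_s)$ is a Hausdorff space, and $\tau\subsetneq\tau_s$, where $\tau$ is the Euclidean topology of $\mathbb{H}$ and $\tau_s$ is the slice-topology of $\mathbb{H}$.
   Context: $\mathbb{H}$ is the skew field of quaternions, $\mathbb{S}=\{q\in\mathbb{H}:q^2=-1\}$, and for $I\in\mathbb{S}$, $\mathbb{C}_I=\{x+yI:x,y\in\mathbb{R}\}$ carries the Euclidean topology. The slice-topology $\tau_s$ on $\mathbb{H}$ is the quotient topology induced by the surjective map $\bigsqcup_{I\in\mathbb{S}}(\mathbb{C}_I\times\{I\})\to\mathbb{H}$, $(q,I)\mapsto q$, where the source carries the disjoint union topology of the Euclidean topologies. *)

theory Defs
  imports "HOL-Analysis.Analysis"
begin

section \<open>Quaternions\<close>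

text \<open>\<open>Quat a b c d\<close> stands for \<open>a + b i + c j + d k\<close>, with \<open>i\<^sup>2 = j\<^sup>2 = k\<^sup>2 = i j k = -1\<close>.\<close>

datatype quat = Quat (qRe: real) (qI: real) (qJ: real) (qK: real)

lemma quat_eq_iff: "p = q \<longleftrightarrow> qRe p = qRe q \<and> qI p = qI q \<and> qJ p = qJ q \<and> qK p = qK q"
  by (cases p; cases q) auto

instantiation quat :: real_div_algebra
begin

definition zero_quat :: quat where "0 = Quat 0 0 0 0"

definition one_quat :: quat where "1 = Quat 1 0 0 0"

definition plus_quat :: "quat \<Rightarrow> quat \<Rightarrow> quat" where
  "p + q = Quat (qRe p + qRe q) (qI p + qI q) (qJ p + qJ q) (qK p + qK q)"

definition uminus_quat :: "quat \<Rightarrow> quat" where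
  "- q = Quat (- qRe q) (- qI q) (- qJ q) (- qK q)"

definition minus_quat :: "quat \<Rightarrow> quat \<Rightarrow> quat" where
  "p - q = Quat (qRe p - qRe q) (qI p - qI q) (qJ p - qJ q) (qK p - qK q)"

definition scaleR_quat :: "real \<Rightarrow> quat \<Rightarrow> quat" where
  "scaleR r q = Quat (r * qRe q) (r * qI q) (r * qJ q) (r * qK q)"

definition times_quat :: "quat \<Rightarrow> quat \<Rightarrow> quat" where
  "p * q = Quat
    (qRe p * qRe q - qI p * qI q - qJ p * qJ q - qK p * qK q)
    (qRe p * qI q + qI p * qRe q + qJ p * qK q - qK p * qJ q)
    (qRe p * qJ q - qI p * qK q + qJ p * qRe q + qK p * qI q)
    (qRe p * qK q + qI p * qJ q - qJ p * qI q + qK p * qRe q)"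

definition inverse_quat :: "quat \<Rightarrow> quat" where
  "inverse q = scaleR (1 / ((qRe q)\<^sup>2 + (qI q)\<^sup>2 + (qJ q)\<^sup>2 + (qK q)\<^sup>2))
    (Quat (qRe q) (- qI q) (- qJ q) (- qK q))"

definition divide_quat :: "quat \<Rightarrow> quat \<Rightarrow> quat" where
  "p div q = p * inverse q" for p q :: quat

lemmas quat_ops_defs = zero_quat_def one_quat_def plus_quat_def uminus_quat_def minus_quat_def
  scaleR_quat_def times_quat_def

lemma quat_sel_simps [simp]:
  "qRe 0 = 0" "qI 0 = 0" "qJ 0 = 0" "qK 0 = 0"
  "qRe 1 = 1" "qI 1 = 0" "qJ 1 = 0" "qK 1 = 0"
  "qRe (p + q) = qRe p + qRe q" "qI (p + q) = qI p + qI q"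
  "qJ (p + q) = qJ p + qJ q" "qK (p + q) = qK p + qK q"
  "qRe (- q) = - qRe q" "qI (- q) = - qI q" "qJ (- q) = - qJ q" "qK (- q) = - qK q"
  "qRe (p - q) = qRe p - qRe q" "qI (p - q) = qI p - qI q"
  "qJ (p - q) = qJ p - qJ q" "qK (p - q) = qK p - qK q"
  "qRe (r *\<^sub>R q) = r * qRe q" "qI (r *\<^sub>R q) = r * qI q"
  "qJ (r *\<^sub>R q) = r * qJ q" "qK (r *\<^sub>R q) = r * qK q"
  by (simp_all add: quat_ops_defs)

lemma quat_times_sel [simp]:
  "qRe (p * q) = qRe p * qRe q - qI p * qI q - qJ p * qJ q - qK p * qK q"
  "qI (p * q) = qRe p * qI q + qI p * qRe q + qJ p * qK q - qK p * qJ q"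
  "qJ (p * q) = qRe p * qJ q - qI p * qK q + qJ p * qRe q + qK p * qI q"
  "qK (p * q) = qRe p * qK q + qI p * qJ q - qJ p * qI q + qK p * qRe q"
  by (simp_all add: times_quat_def)

instance
proof
  fix a b c :: quat and r s :: real
  show "a + b + c = a + (b + c)" "a + b = b + a" "0 + a = a" "- a + a = 0" "a - b = a + - b"
    by (simp_all add: quat_eq_iff)
  show "r *\<^sub>R (a + b) = r *\<^sub>R a + r *\<^sub>R b" "(r + s) *\<^sub>R a = r *\<^sub>R a + s *\<^sub>R a"
    "r *\<^sub>R s *\<^sub>R a = (r * s) *\<^sub>R a" "1 *\<^sub>R a = a"
    by (simp_all add: quat_eq_iff algebra_simps)
  show "a * b * c = a * (b * c)"
    by (simp add: quat_eq_iff algebra_simps)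
  show "(a + b) * c = a * c + b * c" "a * (b + c) = a * b + a * c"
    by (simp_all add: quat_eq_iff algebra_simps)
  show "1 * a = a" "a * 1 = a" "(0 :: quat) \<noteq> 1"
    by (simp_all add: quat_eq_iff)
  show "r *\<^sub>R a * b = r *\<^sub>R (a * b)" "a * r *\<^sub>R b = r *\<^sub>R (a * b)"
    by (simp_all add: quat_eq_iff algebra_simps)
  define N where "N = (qRe a)\<^sup>2 + (qI a)\<^sup>2 + (qJ a)\<^sup>2 + (qK a)\<^sup>2"
  define C where "C = Quat (qRe a) (- qI a) (- qJ a) (- qK a)"
  have inv: "inverse a = (1 / N) *\<^sub>R C"
    by (simp add: inverse_quat_def N_def C_def)
  have nz: "N \<noteq> 0" if "a \<noteq> 0"
    using that by (auto simp: N_def quat_eq_iff add_nonneg_eq_0_iff)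
  have CN: "C * a = N *\<^sub>R 1" "a * C = N *\<^sub>R 1"
    by (simp_all add: C_def N_def quat_eq_iff power2_eq_square)
  have lC: "(x *\<^sub>R C) * a = x *\<^sub>R (C * a)" and rC: "a * (x *\<^sub>R C) = x *\<^sub>R (a * C)" for x
    by (simp_all add: quat_eq_iff algebra_simps)
  have NN: "(1 / N) *\<^sub>R (N *\<^sub>R (1 :: quat)) = 1" if "a \<noteq> 0"
    using nz[OF that] by (simp add: quat_eq_iff)
  show "inverse a * a = 1" if "a \<noteq> 0"
    unfolding inv lC CN by (rule NN[OF that])
  show "a * inverse a = 1" if "a \<noteq> 0"
    unfolding inv rC CN by (rule NN[OF that])
  show "a div b = a * inverse b"
    by (rule divide_quat_def)
  show "inverse (0 :: quat) = 0"
    by (simp add: inverse_quat_def quat_eq_iff)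
qed

end

lemma quat_of_real_sel [simp]:
  "qRe (of_real r) = r" "qI (of_real r) = 0" "qJ (of_real r) = 0" "qK (of_real r) = 0"
  by (simp_all add: of_real_def)

instantiation quat :: real_inner
begin

definition inner_quat :: "quat \<Rightarrow> quat \<Rightarrow> real" where
  "inner p q = qRe p * qRe q + qI p * qI q + qJ p * qJ q + qK p * qK q"

definition norm_quat :: "quat \<Rightarrow> real" where
  "norm q = sqrt (inner q q)" for q :: quat

definition sgn_quat :: "quat \<Rightarrow> quat" where
  "sgn q = q /\<^sub>R norm q" for q :: quat

definition dist_quat :: "quat \<Rightarrow> quat \<Rightarrow> real" where
  "dist p q = norm (p - q)" for p q :: quat

definition uniformity_quat :: "(quat \<times> quat) filter" where
  "uniformity_quat = (INF e\<in>{0<..}. principal {(p, q). dist p q < e})"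

definition open_quat :: "quat set \<Rightarrow> bool" where
  "open_quat U \<longleftrightarrow> (\<forall>p\<in>U. eventually (\<lambda>(p', q). p' = p \<longrightarrow> q \<in> U) uniformity)"

instance
proof
  fix p q s :: quat and r :: real and U :: "quat set"
  show "inner p p = 0 \<longleftrightarrow> p = 0"
    by (auto simp: inner_quat_def quat_eq_iff add_nonneg_eq_0_iff)
qed (simp_all add: inner_quat_def norm_quat_def sgn_quat_def dist_quat_def uniformity_quat_def
       open_quat_def algebra_simps)

end

instantiation quat :: euclidean_space
begin

definition Basis_quat :: "quat set" where
  "Basis = {Quat 1 0 0 0, Quat 0 1 0 0, Quat 0 0 1 0, Quat 0 0 0 1}"

instance
proof
  show "(Basis :: quat set) \<noteq> {}" "finite (Basis :: quat set)"
    by (simp_all add: Basis_quat_def)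
  show "inner u v = (if u = v then 1 else 0)" if "u \<in> Basis" "v \<in> Basis" for u v :: quat
    using that unfolding Basis_quat_def by (elim insertE emptyE; simp add: inner_quat_def)
  show "(\<forall>u\<in>Basis. inner x u = 0) \<longleftrightarrow> x = 0" for x :: quat
    by (cases x) (simp add: Basis_quat_def inner_quat_def zero_quat_def)
qed

end

lemma DIM_quat [simp]: "DIM(quat) = 4"
  by (simp add: Basis_quat_def)


section \<open>The slice-topology\<close>

definition imag_units :: "quat set" where
  "imag_units = {q. q\<^sup>2 = - 1}"

definition slice_plane :: "quat \<Rightarrow> quat set" where
  "slice_plane I = {of_real x + of_real y * I | x y. True}"

definition quotient_topology :: "'a topology \<Rightarrow> ('a \<Rightarrow> 'b) \<Rightarrow> 'b topology" where
  "quotient_topology X f =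
    topology (\<lambda>U. U \<subseteq> f ` topspace X \<and> openin X {x \<in> topspace X. f x \<in> U})"

text \<open>The points of \<open>sum_topology X A\<close> are pairs \<open>(a, x)\<close> with the index first, so the quotient
  map \<open>(q, I) \<mapsto> q\<close> is \<open>snd\<close>.\<close>

definition slice_topology :: "quat topology" where
  "slice_topology =
    quotient_topology (sum_topology (\<lambda>I. top_of_set (slice_plane I)) imag_units) snd"

lemma openin_quotient_topology:
  "openin (quotient_topology X f) U \<longleftrightarrow>
    U \<subseteq> f ` topspace X \<and> openin X {x \<in> topspace X. f x \<in> U}"
proof -
  have "istopology (\<lambda>U. U \<subseteq> f ` topspace X \<and> openin X {x \<in> topspace X. f x \<in> U})"
    unfolding istopology_def
  proof (intro conjI allI impI)
    fix S T
    assume "S \<subseteq> f ` topspace X \<and> openin X {x \<in> topspace X. f x \<in> S}"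
      "T \<subseteq> f ` topspace X \<and> openin X {x \<in> topspace X. f x \<in> T}"
    moreover have "{x \<in> topspace X. f x \<in> S \<inter> T} =
        {x \<in> topspace X. f x \<in> S} \<inter> {x \<in> topspace X. f x \<in> T}" by auto
    ultimately show "S \<inter> T \<subseteq> f ` topspace X" "openin X {x \<in> topspace X. f x \<in> S \<inter> T}"
      by auto
  next
    fix K
    assume K: "\<forall>S\<in>K. S \<subseteq> f ` topspace X \<and> openin X {x \<in> topspace X. f x \<in> S}"
    then show "\<Union>K \<subseteq> f ` topspace X" by auto
    have "{x \<in> topspace X. f x \<in> \<Union>K} = (\<Union>S\<in>K. {x \<in> topspace X. f x \<in> S})" by auto
    then show "openin X {x \<in> topspace X. f x \<in> \<Union>K}" using K by auto
  qed
  then show ?thesis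
    by (simp add: quotient_topology_def)
qed

lemma topspace_quotient_topology [simp]: "topspace (quotient_topology X f) = f ` topspace X"
proof
  show "topspace (quotient_topology X f) \<subseteq> f ` topspace X"
    using openin_quotient_topology[of X f "topspace (quotient_topology X f)"] by simp
  have "{x \<in> topspace X. f x \<in> f ` topspace X} = topspace X" by auto
  then show "f ` topspace X \<subseteq> topspace (quotient_topology X f)"
    by (intro openin_subset) (simp add: openin_quotient_topology)
qed

lemma quotient_map_quotient_topology: "quotient_map X (quotient_topology X f) f"
  by (simp add: quotient_map_def openin_quotient_topology)

lemma UN_slice_plane: "(\<Union>I\<in>imag_units. slice_plane I) = UNIV"
proof -
  have "\<exists>I\<in>imag_units. q \<in> slice_plane I" for q
  proof -
    define n where "n = sqrt ((qI q)\<^sup>2 + (qJ q)\<^sup>2 + (qK q)\<^sup>2)"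
    define I where "I = (if n = 0 then Quat 0 1 0 0 else Quat 0 (qI q / n) (qJ q / n) (qK q / n))"
    have n2: "n\<^sup>2 = (qI q)\<^sup>2 + (qJ q)\<^sup>2 + (qK q)\<^sup>2" by (simp add: n_def)
    have z: "qI q = 0 \<and> qJ q = 0 \<and> qK q = 0" if "n = 0"
      using n2 that by (auto simp: add_nonneg_eq_0_iff)
    have "(qI q / n)\<^sup>2 + (qJ q / n)\<^sup>2 + (qK q / n)\<^sup>2 = 1" if "n \<noteq> 0"
      using that by (simp add: power_divide flip: add_divide_distrib n2)
    then have "I \<in> imag_units"
      by (auto simp: I_def imag_units_def quat_eq_iff power2_eq_square)
    moreover have "q = of_real (qRe q) + of_real n * I"
      using z by (auto simp: I_def quat_eq_iff)
    then have "q \<in> slice_plane I" by (auto simp: slice_plane_def)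
    ultimately show ?thesis by blast
  qed
  then show ?thesis by blast
qed

lemma topspace_slice_topology [simp]: "topspace slice_topology = UNIV"
proof -
  have "topspace slice_topology = (\<Union>I\<in>imag_units. slice_plane I)"
    by (force simp: slice_topology_def)
  then show ?thesis by (simp add: UN_slice_plane)
qed

end

theory Submission
  imports Defs
begin

text \<open>Each plane \<open>\<complex>\<^sub>I\<close> meets the sphere of imaginary units only in \<open>I\<close> and \<open>- I\<close>, so every
  subset of the sphere is closed in the slice-topology. Removing a single point from the sphere
  leaves a set that is not closed in the Euclidean topology, hence the inclusion is strict.
  The Hausdorff property passes from the Euclidean topology to the finer one.\<close>

text \<open>The preimage of \<open>U\<close> under \<open>snd\<close> has the slice
  \<open>slice_plane I \<inter> U\<close> over each index \<open>I\<close>, and openness in a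
  disjoint union is tested index by index.\<close>

lemma openin_slice_topology:
  "openin slice_topology U \<longleftrightarrow>
    (\<forall>I\<in>imag_units. openin (top_of_set (slice_plane I)) (slice_plane I \<inter> U))"
proof -
  let ?X = "sum_topology (\<lambda>I. top_of_set (slice_plane I)) imag_units"
  have "openin slice_topology U \<longleftrightarrow>
      U \<subseteq> topspace slice_topology \<and> openin ?X {x \<in> topspace ?X. snd x \<in> U}"
    unfolding slice_topology_def by (simp only: openin_quotient_topology topspace_quotient_topology)
  moreover have "{x. (I, x) \<in> {x \<in> topspace ?X. snd x \<in> U}} = slice_plane I \<inter> U"
    if "I \<in> imag_units" for I
    using that by auto
  ultimately show ?thesis
    by (auto simp: openin_sum_topology)
qed

lemma open_imp_openin_slice_topology: "openin slice_topology U" if "open U"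
  using that by (simp add: openin_slice_topology openin_open_Int)

text \<open>Since \<open>I * I = - 1\<close>, squaring x + y I gives (x^2 - y^2) + 2xy I. As
  \<open>I\<close> is nonzero with real part 0, comparing with -1 yields xy = 0 and x^2 - y^2 = -1,
  hence x = 0 and y = 1 or y = -1.\<close>

lemma slice_plane_Int_imag_units: "slice_plane I \<inter> imag_units \<subseteq> {I, - I}"
  if I: "I \<in> imag_units"
proof
  fix q assume "q \<in> slice_plane I \<inter> imag_units"
  then obtain x y where q: "q = of_real x + of_real y * I" and q2: "q\<^sup>2 = - 1"
    by (auto simp: slice_plane_def imag_units_def)
  have I2: "I * I = - 1"
    using I by (simp add: imag_units_def power2_eq_square)
  have "q\<^sup>2 = (x\<^sup>2 - y\<^sup>2) *\<^sub>R 1 + (2 * x * y) *\<^sub>R I"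
  proof -
    have "q\<^sup>2 = (x\<^sup>2) *\<^sub>R 1 + (2 * x * y) *\<^sub>R I + (y\<^sup>2) *\<^sub>R (I * I)"
      by (simp add: q quat_eq_iff power2_eq_square algebra_simps)
    then show ?thesis
      by (simp add: I2 algebra_simps)
  qed
  moreover have I0: "qRe I = 0" and "I \<noteq> 0"
  proof -
    have eqs: "(qRe I)\<^sup>2 - (qI I)\<^sup>2 - (qJ I)\<^sup>2 - (qK I)\<^sup>2 = -1"
      "qRe I * qI I = 0" "qRe I * qJ I = 0" "qRe I * qK I = 0"
      using I2 by (auto simp: quat_eq_iff power2_eq_square)
    show "qRe I = 0"
    proof (rule ccontr)
      assume "qRe I \<noteq> 0"
      \<comment> \<open>The mixed products now force the imaginary coordinates to vanish, leaving a
        real number with square -1.\<close>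
      with eqs have "(qRe I)\<^sup>2 = -1" by simp
      then show False using zero_le_power2[of "qRe I"] by linarith
    qed
    show "I \<noteq> 0" using I2 by auto
  qed
  ultimately have "x\<^sup>2 - y\<^sup>2 = -1" "x * y = 0"
    using q2 by (auto simp: quat_eq_iff)
  moreover from this have "y \<noteq> 0"
    using zero_le_power2[of x] by fastforce
  ultimately have "x = 0" "y\<^sup>2 = 1"
    by auto
  then show "q \<in> {I, - I}"
    by (auto simp: q power2_eq_1_iff)
qed

lemma openin_slice_topology_Compl: "openin slice_topology (- A)" if A: "A \<subseteq> imag_units"
  unfolding openin_slice_topology
proof
  fix I assume "I \<in> imag_units"
  then have "slice_plane I \<inter> A \<subseteq> {I, - I}"
    using slice_plane_Int_imag_units A by blast
  then have "open (- (slice_plane I \<inter> A))"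
    by (intro open_Compl finite_imp_closed) (rule finite_subset, auto)
  \<comment> \<open>Within the plane only the finite trace of \<open>A\<close> matters, and its
    complement is Euclidean open even when \<open>- A\<close> is not.\<close>
  moreover have "slice_plane I \<inter> - A = slice_plane I \<inter> - (slice_plane I \<inter> A)" by auto
  ultimately show "openin (top_of_set (slice_plane I)) (slice_plane I \<inter> - A)"
    by (metis openin_open_Int)
qed

text \<open>The point \<open>i\<close> lies in this complement but is a limit of other imaginary
  units.\<close>

lemma not_open_Compl_imag_units:
  defines "i \<equiv> Quat 0 1 0 0"
  shows "\<not> open (- (imag_units - {i}))"
proof
  assume op: "open (- (imag_units - {i}))"
  \<comment> \<open>the rational parametrization of the circle, which passes through \<open>i\<close> only at \<open>t = 0\<close>\<close>
  define f :: "real \<Rightarrow> quat" where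
    "f t = ((1 - t\<^sup>2) / (1 + t\<^sup>2)) *\<^sub>R i + (2 * t / (1 + t\<^sup>2)) *\<^sub>R Quat 0 0 1 0" for t
  have nz: "1 + t\<^sup>2 \<noteq> 0" for t :: real
    using zero_le_power2[of t] by linarith
  have "isCont f 0"
    unfolding f_def by (intro continuous_intros) auto
  then have "(f \<longlongrightarrow> i) (at 0)"
    by (simp add: isCont_def f_def)
  then have "\<forall>\<^sub>F t in at 0. f t \<in> - (imag_units - {i})"
    using op by (rule topological_tendstoD) simp
  moreover have "\<forall>\<^sub>F t in at 0. t \<noteq> (0 :: real)"
    by (simp add: eventually_at_filter)
  ultimately have "\<forall>\<^sub>F t in at (0 :: real). False"
  proof eventually_elim
    case (elim t)
    have "((1 - t\<^sup>2) / (1 + t\<^sup>2))\<^sup>2 + (2 * t / (1 + t\<^sup>2))\<^sup>2 = ((1 - t\<^sup>2)\<^sup>2 + (2 * t)\<^sup>2) / (1 + t\<^sup>2)\<^sup>2"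
      by (simp only: power_divide add_divide_distrib)
    also have "(1 - t\<^sup>2)\<^sup>2 + (2 * t)\<^sup>2 = (1 + t\<^sup>2)\<^sup>2"
      by (simp add: power2_eq_square algebra_simps)
    finally have "((1 - t\<^sup>2) / (1 + t\<^sup>2))\<^sup>2 + (2 * t / (1 + t\<^sup>2))\<^sup>2 = 1"
      using nz[of t] by simp
    \<comment> \<open>A purely imaginary quaternion of norm 1 squares to -1.\<close>
    then have "f t \<in> imag_units"
      by (simp add: imag_units_def f_def i_def quat_eq_iff power2_eq_square)
    \<comment> \<open>For nonzero \<open>t\<close> the j-coordinate 2t / (1 + t^2) does not
      vanish.\<close>
    moreover have "f t \<noteq> i"
      using elim(2) nz[of t] by (simp add: f_def i_def quat_eq_iff)
    ultimately show False using elim(1) by blast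
  qed
  \<comment> \<open>On the reals \<open>at 0\<close> is a proper filter.\<close>
  then show False by simp
qed

theorem proposition3p3:
  shows "Hausdorff_space slice_topology \<and>
    {U. openin (euclidean :: quat topology) U} \<subset> {U. openin slice_topology U}"
proof
  show "Hausdorff_space slice_topology"
    unfolding Hausdorff_space_def disjnt_def
    by (metis hausdorff open_imp_openin_slice_topology)
  let ?U = "- (imag_units - {Quat 0 1 0 0})"
  have "openin slice_topology ?U"
    by (rule openin_slice_topology_Compl) blast
  then show "{U. openin (euclidean :: quat topology) U} \<subset> {U. openin slice_topology U}"
    using not_open_Compl_imag_units open_imp_openin_slice_topology by (auto simp flip: open_openin)
qed

end
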